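(* Let $\mathcal{I}$ be a compositional graphoid over a finite set $V$, let $i,j\in V$ with $i\neq j$, and let $C\subseteq V\setminus\{i,j\}$. The following are equivalent: (a) $j\perp\!\!\!\perp i\mid C$; (b) there is a neighbourhood lattice $\mathfrak{T}_j(S_0)=[m,M]$ (for some $S_0\subseteq V_{-j}$, where $m=m(j;S_0)$) such that $i\in M\setminus m$ and $C\in[m,M\setminus\{i\}]$; (c) $C\in\mathfrak{T}_j(C\cup\{i\})$; (d) $m(j;C\cup\{i\})\subseteq C$.
   Context: Notation: $V_{-j}=V\setminus\{j\}$; braces of singletons are dropped and juxtaposition denotes union ($BD=B\cup D$). For $A\subseteq B$, $[A,B]=\{U:\ A\subseteq U\subseteq B\}$. An independence model over $V$ is a ternary relation $A\perp\!\!\!\perp B\mid C$ on pairwise disjoint subsets $A,B,C\subseteq V$. It is a graphoid if, for all pairwise disjoint $A,B,C,D\subseteq V$: (G1) $A\perp\!\!\!\perp\emptyset\mid C$; (G2) $A\perp\!\!\!\perp B\mid C\Rightarrow B\perp\!\!\!\perp A\mid C$; (G3) $A\perp\!\!\!\perp BD\mid C\Rightarrow A\perp\!\!\!\perp B\mid C$ and $A\perp\!\!\!\perp D\mid C$; (G4) $A\perp\!\!\!\perp BD\mid C\Rightarrow A\perp\!\!\!\perp B\mid CD$; (G5) $A\perp\!\!\!\perp B\mid C$ and $A\perp\!\!\!\perp D\mid BC\Rightarrow A\perp\!\!\!\perp BD\mid C$; (G6) $A\perp\!\!\!\perp B\mid CD$ and $A\perp\!\!\!\perp C\mid BD\Rightarrow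 A\perp\!\!\!\perp BC\mid D$. It is a compositional graphoid if moreover (G7) $A\perp\!\!\!\perp B\mid C$ and $A\perp\!\!\!\perp D\mid C\Rightarrow A\perp\!\!\!\perp BD\mid C$. For $j\in V$ and $S\subseteq V_{-j}$, the relative Markov boundary is $m(j;S)=\bigcap\{U\subseteq S:\ j\perp\!\!\!\perp S\setminus U\mid U\}$, and the neighbourhood lattice of $j$ relative to $S$ is $\mathfrak{T}_j(S)=\{U\subseteq V_{-j}:\ m(j;U)=m(j;S)\}$. For a compositional graphoid, $\mathfrak{T}_j(S)$ is an interval $[m(j;S),M(j;S)]$ of $(2^{V_{-j}},\subseteq)$, where $M(j;S)=\sup\mathfrak{T}_j(S)$. *)

theory Defs
  imports Main
begin

(* An independence model over V is a predicate I, where "I A B C" reads "A is independent of B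
   given C".  Only its values on pairwise disjoint subsets of V are meaningful: all axioms are
   guarded accordingly, and no definition below looks at I elsewhere when j \<in> V and
   S \<subseteq> V - {j}. *)

(* sorted_wrt instead of set-based pairwise disjointness: the same (empty) set may be listed
   repeatedly, and equal nonempty entries must be rejected. *)
definition disjoint_subsets :: "'a set \<Rightarrow> 'a set list \<Rightarrow> bool" where
  "disjoint_subsets V Xs \<longleftrightarrow> (\<forall>X\<in>set Xs. X \<subseteq> V) \<and> sorted_wrt disjnt Xs"

locale graphoid =
  fixes V :: "'a set" and I :: "'a set \<Rightarrow> 'a set \<Rightarrow> 'a set \<Rightarrow> bool"
  assumes empty: "disjoint_subsets V [A, C] \<Longrightarrow> I A {} C"
    and symmetry: "disjoint_subsets V [A, B, C] \<Longrightarrow> I A B C \<Longrightarrow> I B A C"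
    and decomposition: "disjoint_subsets V [A, B, C, D] \<Longrightarrow> I A (B \<union> D) C \<Longrightarrow> I A B C \<and> I A D C"
    and weak_union: "disjoint_subsets V [A, B, C, D] \<Longrightarrow> I A (B \<union> D) C \<Longrightarrow> I A B (C \<union> D)"
    and contraction:
      "disjoint_subsets V [A, B, C, D] \<Longrightarrow> I A B C \<Longrightarrow> I A D (B \<union> C) \<Longrightarrow> I A (B \<union> D) C"
    and intersection:
      "disjoint_subsets V [A, B, C, D] \<Longrightarrow> I A B (C \<union> D) \<Longrightarrow> I A C (B \<union> D) \<Longrightarrow> I A (B \<union> C) D"

locale compositional_graphoid = graphoid +
  assumes composition:
    "disjoint_subsets V [A, B, C, D] \<Longrightarrow> I A B C \<Longrightarrow> I A D C \<Longrightarrow> I A (B \<union> D) C"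

(* In a graphoid the family contains U = S, so the intersection is never over the empty family. *)
definition rel_markov_boundary ::
    "('a set \<Rightarrow> 'a set \<Rightarrow> 'a set \<Rightarrow> bool) \<Rightarrow> 'a \<Rightarrow> 'a set \<Rightarrow> 'a set" where
  "rel_markov_boundary I j S = \<Inter>{U. U \<subseteq> S \<and> I {j} (S - U) U}"

definition nbhd_lattice ::
    "'a set \<Rightarrow> ('a set \<Rightarrow> 'a set \<Rightarrow> 'a set \<Rightarrow> bool) \<Rightarrow> 'a \<Rightarrow> 'a set \<Rightarrow> 'a set set" where
  "nbhd_lattice V I j S =
     {U. U \<subseteq> V - {j} \<and> rel_markov_boundary I j U = rel_markov_boundary I j S}"

(* Suprema in the lattice of subsets of V - {j} are unions. *)
definition nbhd_lattice_top ::
    "'a set \<Rightarrow> ('a set \<Rightarrow> 'a set \<Rightarrow> 'a set \<Rightarrow> bool) \<Rightarrow> 'a \<Rightarrow> 'a set \<Rightarrow> 'a set" where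
  "nbhd_lattice_top V I j S = \<Union>(nbhd_lattice V I j S)"

end

(* In any graphoid the Markov blankets U of j in S, i.e. the sets U with j independent of S - U
   given U, are exactly the members of the interval [m(j;S), S]; here finiteness and the
   intersection axiom make m(j;S) itself a blanket.  Taking U = C and S = C + i identifies (a)
   with (d).  Shrinking S to a blanket does not change the boundary (contraction), which gives
   (c).  Composition makes the neighbourhood lattice closed under unions, so it has a largest
   element and is an interval; (b) says that C and C + i both lie in one such interval. *)

theory Submission
  imports Defs
begin

definition markov_blanket :: "('a set \<Rightarrow> 'a set \<Rightarrow> 'a set \<Rightarrow> bool) \<Rightarrow> 'a \<Rightarrow> 'a set \<Rightarrow> 'a set \<Rightarrow> bool" where
  "markov_blanket I j S U \<longleftrightarrow> U \<subseteq> S \<and> I {j} (S - U) U"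

lemma rel_markov_boundary_eq_Inter:
  "rel_markov_boundary I j S = \<Inter>{U. markov_blanket I j S U}"
  by (simp add: rel_markov_boundary_def markov_blanket_def)

lemma rel_markov_boundary_least:
  "markov_blanket I j S U \<Longrightarrow> rel_markov_boundary I j S \<subseteq> U"
  by (auto simp: rel_markov_boundary_eq_Inter)

context graphoid
begin

lemma markov_blanket_refl:
  assumes "j \<in> V" "S \<subseteq> V - {j}"
  shows "markov_blanket I j S S"
  using assms empty[of "{j}" S]
  by (auto simp: markov_blanket_def disjoint_subsets_def disjnt_def)

text \<open>The parts \<open>B\<close> and \<open>D\<close> in which the two blankets differ are
  stripped from the conditioning sets by the intersection axiom; contraction then restores
  \<open>R\<close>, the part of \<open>S\<close> outside both blankets.\<close>

lemma markov_blanket_Int: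
  assumes j: "j \<in> V" "S \<subseteq> V - {j}"
    and U: "markov_blanket I j S U" and W: "markov_blanket I j S W"
  shows "markov_blanket I j S (U \<inter> W)"
proof -
  define B D R where "B = U - W" and "D = W - U" and "R = S - (U \<union> W)"
  have sub: "U \<subseteq> S" "W \<subseteq> S"
    using U W by (auto simp: markov_blanket_def)
  have disj: "disjoint_subsets V [{j}, D, U, R]" "disjoint_subsets V [{j}, R, U, D]"
    "disjoint_subsets V [{j}, B, W, R]" "disjoint_subsets V [{j}, B, D, U \<inter> W]"
    "disjoint_subsets V [{j}, B \<union> D, U \<inter> W, R]"
    using j sub by (auto simp: disjoint_subsets_def disjnt_def B_def D_def R_def)
  have eqs: "S - U = D \<union> R" "S - W = B \<union> R"
    using sub by (auto simp: B_def D_def R_def)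
  have UDR: "I {j} (D \<union> R) U" and WBR: "I {j} (B \<union> R) W"
    using U W eqs by (simp_all add: markov_blanket_def)
  have "I {j} D U" "I {j} B W"
    using decomposition[OF disj(1) UDR] decomposition[OF disj(3) WBR] by simp_all
  moreover have "D \<union> U \<inter> W = W" "B \<union> U \<inter> W = U"
    by (auto simp: B_def D_def)
  ultimately have BD: "I {j} (B \<union> D) (U \<inter> W)"
    using intersection[OF disj(4)] by simp
  \<comment> \<open>Weak union enlarges the conditioning set to \<open>U\<close> \<union>
    \<open>W\<close>, which is also \<open>B\<close> \<union> \<open>D\<close> together with
    \<open>U\<close> \<inter> \<open>W\<close>, the form that contraction asks for.\<close>
  have "I {j} R (U \<union> D)"
    using weak_union[OF disj(2)] UDR by (simp add: Un_commute)
  moreover have "U \<union> D = B \<union> D \<union> U \<inter> W"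
    by (auto simp: B_def D_def)
  ultimately have "I {j} (B \<union> D \<union> R) (U \<inter> W)"
    using contraction[OF disj(5) BD] by simp
  moreover have "B \<union> D \<union> R = S - U \<inter> W"
    using sub by (auto simp: B_def D_def R_def)
  ultimately show ?thesis
    using sub by (auto simp: markov_blanket_def)
qed

text \<open>Weak union moves \<open>W - U\<close> from the independent side into the conditioning
  set.\<close>

lemma markov_blanket_mono:
  assumes j: "j \<in> V" "S \<subseteq> V - {j}"
    and U: "markov_blanket I j S U" and sub: "U \<subseteq> W" "W \<subseteq> S"
  shows "markov_blanket I j S W"
proof -
  have "disjoint_subsets V [{j}, S - W, U, W - U]"
    using j sub by (auto simp: disjoint_subsets_def disjnt_def)
  moreover have "S - U = (S - W) \<union> (W - U)" and "U \<union> (W - U) = W"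
    using sub by auto
  ultimately have "I {j} (S - W) W"
    using U weak_union[of "{j}" "S - W" U "W - U"] by (simp add: markov_blanket_def)
  then show ?thesis
    using sub by (simp add: markov_blanket_def)
qed

text \<open>Decomposition discards \<open>S - W\<close> from the independent side.\<close>

lemma markov_blanket_restrict:
  assumes j: "j \<in> V" "S \<subseteq> V - {j}"
    and U: "markov_blanket I j S U" and sub: "U \<subseteq> W" "W \<subseteq> S"
  shows "markov_blanket I j W U"
proof -
  have "disjoint_subsets V [{j}, W - U, U, S - W]"
    using j sub by (auto simp: disjoint_subsets_def disjnt_def)
  moreover have "S - U = (W - U) \<union> (S - W)"
    using sub by auto
  ultimately have "I {j} (W - U) U"
    using U decomposition[of "{j}" "W - U" U "S - W"] by (simp add: markov_blanket_def)
  then show ?thesis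
    using sub by (simp add: markov_blanket_def)
qed

text \<open>Contraction glues the independence of \<open>W - U\<close> given \<open>U\<close> to
  that of \<open>S - W\<close> given \<open>W\<close>.\<close>

lemma markov_blanket_trans:
  assumes j: "j \<in> V" "S \<subseteq> V - {j}"
    and W: "markov_blanket I j S W" and U: "markov_blanket I j W U"
  shows "markov_blanket I j S U"
proof -
  have sub: "U \<subseteq> W" "W \<subseteq> S"
    using U W by (auto simp: markov_blanket_def)
  have "disjoint_subsets V [{j}, W - U, U, S - W]"
    using j sub by (auto simp: disjoint_subsets_def disjnt_def)
  moreover have "W - U \<union> U = W" and "(W - U) \<union> (S - W) = S - U"
    using sub by auto
  ultimately have "I {j} (S - U) U"
    using U W contraction[of "{j}" "W - U" U "S - W"] by (simp add: markov_blanket_def)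
  then show ?thesis
    using sub by (simp add: markov_blanket_def)
qed

text \<open>The blankets form a finite family, being subsets of \<open>S\<close>, and a nonempty
  one, since \<open>S\<close> belongs to it; so closure under binary intersections suffices.\<close>

lemma markov_blanket_rel_markov_boundary:
  assumes "finite S" and j: "j \<in> V" "S \<subseteq> V - {j}"
  shows "markov_blanket I j S (rel_markov_boundary I j S)"
proof -
  have "markov_blanket I j S (\<Inter>F)"
    if "finite F" "F \<noteq> {}" "F \<subseteq> {U. markov_blanket I j S U}" for F
    using that
    by (induction F rule: finite_ne_induct) (auto intro: markov_blanket_Int[OF j])
  moreover have "finite {U. markov_blanket I j S U}"
    by (rule finite_subset[of _ "Pow S"]) (auto simp: markov_blanket_def \<open>finite S\<close>)
  ultimately show ?thesis
    using markov_blanket_refl[OF j] unfolding rel_markov_boundary_eq_Inter by blast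
qed

lemma rel_markov_boundary_subset:
  assumes "j \<in> V" "S \<subseteq> V - {j}"
  shows "rel_markov_boundary I j S \<subseteq> S"
  by (rule rel_markov_boundary_least[OF markov_blanket_refl[OF assms]])

lemma markov_blanket_iff:
  assumes "finite S" and j: "j \<in> V" "S \<subseteq> V - {j}"
  shows "markov_blanket I j S U \<longleftrightarrow> rel_markov_boundary I j S \<subseteq> U \<and> U \<subseteq> S"
  using markov_blanket_mono[OF j markov_blanket_rel_markov_boundary[OF assms]]
    rel_markov_boundary_least markov_blanket_def by metis

text \<open>Each boundary is a blanket for the other set: that of \<open>S\<close> restricts to
  \<open>U\<close>, and that of \<open>U\<close> extends to \<open>S\<close> because
  \<open>U\<close> is itself a blanket in \<open>S\<close>. Minimality gives both
  inclusions.\<close>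

lemma rel_markov_boundary_cong:
  assumes "finite S" and j: "j \<in> V" "S \<subseteq> V - {j}"
    and sub: "rel_markov_boundary I j S \<subseteq> U" "U \<subseteq> S"
  shows "rel_markov_boundary I j U = rel_markov_boundary I j S"
proof
  have U: "finite U" "U \<subseteq> V - {j}"
    using assms by (auto intro: finite_subset)
  show "rel_markov_boundary I j U \<subseteq> rel_markov_boundary I j S"
    using markov_blanket_restrict[OF j markov_blanket_rel_markov_boundary[OF assms(1) j] sub]
    by (rule rel_markov_boundary_least)
  have "markov_blanket I j S U"
    using sub by (simp add: markov_blanket_iff[OF assms(1) j])
  then have "markov_blanket I j S (rel_markov_boundary I j U)"
    using markov_blanket_rel_markov_boundary[OF U(1) j(1) U(2)]
    by (rule markov_blanket_trans[OF j])
  then show "rel_markov_boundary I j S \<subseteq> rel_markov_boundary I j U"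
    by (rule rel_markov_boundary_least)
qed

lemma indep_iff_rel_markov_boundary_subset:
  assumes "finite C" "i \<in> V" "j \<in> V" "i \<noteq> j" "C \<subseteq> V - {i, j}"
  shows "I {j} {i} C \<longleftrightarrow> rel_markov_boundary I j (C \<union> {i}) \<subseteq> C"
proof -
  have "C \<union> {i} - C = {i}"
    using assms by auto
  then have "I {j} {i} C \<longleftrightarrow> markov_blanket I j (C \<union> {i}) C"
    by (auto simp: markov_blanket_def)
  also have "\<dots> \<longleftrightarrow> rel_markov_boundary I j (C \<union> {i}) \<subseteq> C"
    using assms by (subst markov_blanket_iff) auto
  finally show ?thesis .
qed

text \<open>If the boundary of \<open>C \<union> {i}\<close> lies in \<open>C\<close>, then
  \<open>C\<close> sits between that boundary and \<open>C \<union> {i}\<close>, so its own boundary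
  is the same. Conversely, a common boundary is contained in \<open>C\<close> because it is the
  boundary of \<open>C\<close>.\<close>

lemma rel_markov_boundary_subset_iff_nbhd_lattice:
  assumes "finite C" "i \<in> V" "j \<in> V" "i \<noteq> j" "C \<subseteq> V - {i, j}"
  shows "rel_markov_boundary I j (C \<union> {i}) \<subseteq> C \<longleftrightarrow> C \<in> nbhd_lattice V I j (C \<union> {i})"
proof
  assume "rel_markov_boundary I j (C \<union> {i}) \<subseteq> C"
  then show "C \<in> nbhd_lattice V I j (C \<union> {i})"
    using assms rel_markov_boundary_cong[of "C \<union> {i}" j C] by (auto simp: nbhd_lattice_def)
next
  assume "C \<in> nbhd_lattice V I j (C \<union> {i})"
  then show "rel_markov_boundary I j (C \<union> {i}) \<subseteq> C"
    using assms rel_markov_boundary_subset[of j C] by (auto simp: nbhd_lattice_def)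
qed

end

context compositional_graphoid
begin

text \<open>The common boundary \<open>m\<close> is a blanket in both \<open>X\<close> and
  \<open>Y\<close>, and composition makes it a blanket in their union.\<close>

lemma nbhd_lattice_Un:
  assumes "finite V" "j \<in> V"
    and X: "X \<in> nbhd_lattice V I j S" and Y: "Y \<in> nbhd_lattice V I j S"
  shows "X \<union> Y \<in> nbhd_lattice V I j S"
proof -
  define m where "m = rel_markov_boundary I j S"
  have XY: "X \<subseteq> V - {j}" "Y \<subseteq> V - {j}" "X \<union> Y \<subseteq> V - {j}"
    and mXY: "rel_markov_boundary I j X = m" "rel_markov_boundary I j Y = m"
    using X Y by (auto simp: nbhd_lattice_def m_def)
  have fin: "finite X" "finite Y" "finite (X \<union> Y)"
    using XY \<open>finite V\<close> by (auto intro: finite_subset)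
  have bl: "markov_blanket I j X m" "markov_blanket I j Y m"
    using markov_blanket_rel_markov_boundary[OF fin(1) assms(2) XY(1)]
      markov_blanket_rel_markov_boundary[OF fin(2) assms(2) XY(2)] mXY by simp_all
  then have sub: "m \<subseteq> X" "m \<subseteq> Y"
    by (simp_all add: markov_blanket_def)
  have disj: "disjoint_subsets V [{j}, Y - X, m, X \<inter> Y - m]"
    "disjoint_subsets V [{j}, X - m, m, Y - X]"
    using \<open>j \<in> V\<close> XY sub by (auto simp: disjoint_subsets_def disjnt_def)
  have "Y - m = (Y - X) \<union> (X \<inter> Y - m)"
    using sub by auto
  \<comment> \<open>Composition is stated for disjoint sets, while \<open>X - m\<close> and
    \<open>Y - m\<close> may overlap, so the overlap is removed from the second.\<close>
  then have "I {j} (Y - X) m"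
    using bl(2) decomposition[OF disj(1)] by (simp add: markov_blanket_def)
  then have "I {j} ((X - m) \<union> (Y - X)) m"
    using bl(1) composition[OF disj(2)] by (simp add: markov_blanket_def)
  moreover have "(X - m) \<union> (Y - X) = X \<union> Y - m"
    using sub by auto
  ultimately have "markov_blanket I j (X \<union> Y) m"
    using sub by (auto simp: markov_blanket_def)
  then have "rel_markov_boundary I j (X \<union> Y) \<subseteq> m"
    by (rule rel_markov_boundary_least)
  \<comment> \<open>\<open>X\<close> contains \<open>m\<close>, hence lies between the boundary of
    the union and the union itself.\<close>
  then have "rel_markov_boundary I j X = rel_markov_boundary I j (X \<union> Y)"
    using sub by (intro rel_markov_boundary_cong[OF fin(3) \<open>j \<in> V\<close> XY(3)]) auto
  then show ?thesis
    using XY mXY by (simp add: nbhd_lattice_def m_def)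
qed

lemma nbhd_lattice_top_in_nbhd_lattice:
  assumes "finite V" "j \<in> V" "S \<subseteq> V - {j}"
  shows "nbhd_lattice_top V I j S \<in> nbhd_lattice V I j S"
proof -
  have "\<Union>F \<in> nbhd_lattice V I j S"
    if "finite F" "F \<noteq> {}" "F \<subseteq> nbhd_lattice V I j S" for F
    using that
    by (induction F rule: finite_ne_induct) (auto intro: nbhd_lattice_Un[OF assms(1,2)])
  moreover have "finite (nbhd_lattice V I j S)"
    by (rule finite_subset[of _ "Pow V"]) (auto simp: nbhd_lattice_def \<open>finite V\<close>)
  moreover have "S \<in> nbhd_lattice V I j S"
    using assms by (simp add: nbhd_lattice_def)
  ultimately show ?thesis
    unfolding nbhd_lattice_top_def by blast
qed

text \<open>Boundaries are compared with the top \<open>?M\<close> rather than with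
  \<open>S\<close>: members of the interval need not be subsets of \<open>S\<close>, but they all
  lie between the boundary of \<open>?M\<close> and \<open>?M\<close>.\<close>

lemma nbhd_lattice_eq_interval:
  assumes "finite V" "j \<in> V" "S \<subseteq> V - {j}"
  shows "nbhd_lattice V I j S = {rel_markov_boundary I j S..nbhd_lattice_top V I j S}"
proof -
  let ?M = "nbhd_lattice_top V I j S"
  have M: "?M \<subseteq> V - {j}" "rel_markov_boundary I j ?M = rel_markov_boundary I j S"
    using nbhd_lattice_top_in_nbhd_lattice[OF assms] by (auto simp: nbhd_lattice_def)
  have "finite ?M"
    using M \<open>finite V\<close> by (auto intro: finite_subset)
  then have "U \<in> nbhd_lattice V I j S" if "rel_markov_boundary I j S \<subseteq> U" "U \<subseteq> ?M" for U
    using that M rel_markov_boundary_cong[of ?M j U] \<open>j \<in> V\<close> by (auto simp: nbhd_lattice_def)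
  moreover have "rel_markov_boundary I j S \<subseteq> U \<and> U \<subseteq> ?M" if "U \<in> nbhd_lattice V I j S" for U
    using that rel_markov_boundary_subset[of j U] \<open>j \<in> V\<close>
    by (auto simp: nbhd_lattice_def nbhd_lattice_top_def)
  ultimately show ?thesis
    unfolding set_eq_iff atLeastAtMost_iff by blast
qed

end

theorem corollary3p3:
  fixes V :: "'a set" and I :: "'a set \<Rightarrow> 'a set \<Rightarrow> 'a set \<Rightarrow> bool"
    and i j :: 'a and C :: "'a set"
  assumes "finite V" and "compositional_graphoid V I"
    and "i \<in> V" and "j \<in> V" and "i \<noteq> j" and "C \<subseteq> V - {i, j}"
  shows "(I {j} {i} C \<longleftrightarrow>
           (\<exists>S\<^sub>0 m M. S\<^sub>0 \<subseteq> V - {j} \<and>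
              m = rel_markov_boundary I j S\<^sub>0 \<and> M = nbhd_lattice_top V I j S\<^sub>0 \<and>
              nbhd_lattice V I j S\<^sub>0 = {m..M} \<and>
              i \<in> M - m \<and> C \<in> {m..M - {i}})) \<and>
         (I {j} {i} C \<longleftrightarrow> C \<in> nbhd_lattice V I j (C \<union> {i})) \<and>
         (I {j} {i} C \<longleftrightarrow> rel_markov_boundary I j (C \<union> {i}) \<subseteq> C)"
proof -
  interpret compositional_graphoid V I
    by fact
  have fin: "finite C" and CV: "C \<subseteq> V - {j}" "C \<union> {i} \<subseteq> V - {j}" and "i \<notin> C"
    using assms by (auto intro: finite_subset)
  have ad: "I {j} {i} C \<longleftrightarrow> rel_markov_boundary I j (C \<union> {i}) \<subseteq> C"
    using indep_iff_rel_markov_boundary_subset[OF fin assms(3-6)] .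
  have dc: "rel_markov_boundary I j (C \<union> {i}) \<subseteq> C \<longleftrightarrow> C \<in> nbhd_lattice V I j (C \<union> {i})"
    using rel_markov_boundary_subset_iff_nbhd_lattice[OF fin assms(3-6)] .
  have "\<exists>S\<^sub>0 m M. S\<^sub>0 \<subseteq> V - {j} \<and>
      m = rel_markov_boundary I j S\<^sub>0 \<and> M = nbhd_lattice_top V I j S\<^sub>0 \<and>
      nbhd_lattice V I j S\<^sub>0 = {m..M} \<and> i \<in> M - m \<and> C \<in> {m..M - {i}}"
    if "C \<in> nbhd_lattice V I j (C \<union> {i})"
  proof -
    \<comment> \<open>The witness for \<open>S\<^sub>0\<close> is \<open>C\<close>. Equality of
      boundaries puts \<open>C \<union> {i}\<close> in its lattice, so \<open>i\<close> is in the
      top; it is not in the boundary, which is contained in \<open>C\<close>.\<close>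
    have "C \<union> {i} \<in> nbhd_lattice V I j C" "C \<in> nbhd_lattice V I j C"
      using that CV by (auto simp: nbhd_lattice_def)
    then have "C \<union> {i} \<subseteq> nbhd_lattice_top V I j C"
      by (auto simp: nbhd_lattice_top_def)
    moreover have "rel_markov_boundary I j C \<subseteq> C"
      using rel_markov_boundary_subset[OF \<open>j \<in> V\<close> CV(1)] .
    ultimately show ?thesis
      using nbhd_lattice_eq_interval[OF \<open>finite V\<close> \<open>j \<in> V\<close> CV(1)] CV \<open>i \<notin> C\<close>
      by (intro exI[of _ C] exI conjI refl) auto
  qed
  moreover have "C \<in> nbhd_lattice V I j (C \<union> {i})"
    if "nbhd_lattice V I j S = {m..M}" "i \<in> M - m" "C \<in> {m..M - {i}}" for S m M
  proof -
    \<comment> \<open>Since \<open>i\<close> is in \<open>M\<close>, adding it to \<open>C\<close>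
      stays inside the interval, so both sets have the boundary of \<open>S\<close>.\<close>
    have "C \<in> nbhd_lattice V I j S" "C \<union> {i} \<in> nbhd_lattice V I j S"
      using that by auto
    then show ?thesis
      by (auto simp: nbhd_lattice_def)
  qed
  ultimately show ?thesis
    unfolding ad dc by blast
qed

end
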